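(* Let $V$ be the set of all strings over the alphabet $\{A,B\}$ reachable from $AA$ by finitely many applications of the string substitution rule $A\to AB$. Let $\mathcal{M}$ be the multiway rewriting system on $V$ whose (vertical) rewrite rule is $A\to AB$, enhanced with the homotopy (horizontal) rules $$AAB \leftrightarrow ABA,\quad AABB\leftrightarrow ABBA,\quad AABBB\leftrightarrow ABBBA,\quad ABABBB\leftrightarrow ABBBAB,\quad ABBABBB\leftrightarrow ABBBABB,$$ where $\leftrightarrow$ means that both the rule from left to right and the rule from right to left are included. Then $\mathcal{M}$ is an order-2 homotopy rewriting system, with a 2-morphism between the two paths $$AA\to AAB\to AABB\to AABBB\to ABABBB\to ABBABBB\to ABBBABBB$$ and $$AA\to ABA\to ABBA\to ABBBA\to ABBBAB\to ABBBABB\to ABBBABBB,$$ and the states, vertical morphisms, horizontal morphisms and squares of $\mathcal{M}$ form a double category $\mathcal{M}_1\rightrightarrows\mathcal{M}_0$.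
   Context: A string substitution rule $u\to v$ rewrites a string $xuy$ to $xvy$. The states of $\mathcal{M}$ are the elements of $V$. There is a vertical edge $s\to t$ exactly when $t$ is obtained from $s$ by one application of $A\to AB$, and a horizontal edge $s\to t$ exactly when $t$ is obtained from $s$ by one application of one of the homotopy rules. Vertical (resp. horizontal) morphisms are finite directed paths of vertical (resp. horizontal) edges, including the empty path at each state as identity, composed by concatenation. The category $\mathcal{M}_0$ has the states as objects and the vertical morphisms as morphisms. A frame consists of states $a,b,c,d$, vertical morphisms $l:a\to b$ and $m:c\to d$, and horizontal morphisms $f:a\to c$ and $g:b\to d$. Commutativity is imposed on squares formed by vertical and horizontal morphisms: each frame bounds exactly one square (2-cell), regarded as a morphism $f\to g$ of $\mathcal{M}_1$. The category $\mathcal{M}_1$ has the horizontal morphisms as objects and the squares as morphisms. Its composition is vertical pasting (the vertical sides are composed), and horizontal composition of squares is horizontal pasting (the horizontal sides are composed). A double category $D_1\rightrightarrows D_0$ is a category internal to $\mathbf{Cat}$: its objects are the objects of $D_0$, its vertical morphisms are the morphisms of $D_0$, its horizontal morphisms are the objects of $D_1$, and its 2-morphisms (squares) are the morphisms of $D_1$. A 2-morphism between two vertical paths $p,q$ with the same start and the same end is a vertical composite of squares such that the left sides compose to $p$, the right sides compose to $q$, the outermost top and bottom horizontal sides are identities (so the first and last squares are triangles regarded as squares), and all intermediate horizontal sides are single homotopy-rule edges. An order-2 homotopy rewriting system is a multiway rewriting system together with homotopy rules giving such 2-morphisms between paths. *)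

theory Defs
  imports Main
begin

section \<open>Small categories, functors, and categories internal to Cat\<close>

text \<open>Composition is written in diagrammatic order throughout: \<open>Comp C f g\<close> is \<open>f\<close> followed by \<open>g\<close>.\<close>

record ('o, 'm) cat =
  Obj :: "'o set"
  Arr :: "'m set"
  Dom :: "'m \<Rightarrow> 'o"
  Cod :: "'m \<Rightarrow> 'o"
  Id :: "'o \<Rightarrow> 'm"
  Comp :: "'m \<Rightarrow> 'm \<Rightarrow> 'm"

locale category =
  fixes C :: "('o, 'm) cat"
  assumes Dom_in: "f \<in> Arr C \<Longrightarrow> Dom C f \<in> Obj C"
    and Cod_in: "f \<in> Arr C \<Longrightarrow> Cod C f \<in> Obj C"
    and Id_in: "a \<in> Obj C \<Longrightarrow> Id C a \<in> Arr C"
    and Dom_Id: "a \<in> Obj C \<Longrightarrow> Dom C (Id C a) = a"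
    and Cod_Id: "a \<in> Obj C \<Longrightarrow> Cod C (Id C a) = a"
    and Comp_in: "\<lbrakk>f \<in> Arr C; g \<in> Arr C; Cod C f = Dom C g\<rbrakk> \<Longrightarrow> Comp C f g \<in> Arr C"
    and Dom_Comp: "\<lbrakk>f \<in> Arr C; g \<in> Arr C; Cod C f = Dom C g\<rbrakk> \<Longrightarrow> Dom C (Comp C f g) = Dom C f"
    and Cod_Comp: "\<lbrakk>f \<in> Arr C; g \<in> Arr C; Cod C f = Dom C g\<rbrakk> \<Longrightarrow> Cod C (Comp C f g) = Cod C g"
    and Comp_Id_left: "f \<in> Arr C \<Longrightarrow> Comp C (Id C (Dom C f)) f = f"
    and Comp_Id_right: "f \<in> Arr C \<Longrightarrow> Comp C f (Id C (Cod C f)) = f"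
    and Comp_assoc: "\<lbrakk>f \<in> Arr C; g \<in> Arr C; h \<in> Arr C; Cod C f = Dom C g; Cod C g = Dom C h\<rbrakk>
      \<Longrightarrow> Comp C (Comp C f g) h = Comp C f (Comp C g h)"

record ('o1, 'm1, 'o2, 'm2) fctr =
  on_obj :: "'o1 \<Rightarrow> 'o2"
  on_arr :: "'m1 \<Rightarrow> 'm2"

locale cat_functor = dom: category C + cod: category D
  for C :: "('o1, 'm1) cat" and D :: "('o2, 'm2) cat" +
  fixes F :: "('o1, 'm1, 'o2, 'm2) fctr"
  assumes on_obj_in: "a \<in> Obj C \<Longrightarrow> on_obj F a \<in> Obj D"
    and on_arr_in: "f \<in> Arr C \<Longrightarrow> on_arr F f \<in> Arr D"
    and Dom_on_arr: "f \<in> Arr C \<Longrightarrow> Dom D (on_arr F f) = on_obj F (Dom C f)"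
    and Cod_on_arr: "f \<in> Arr C \<Longrightarrow> Cod D (on_arr F f) = on_obj F (Cod C f)"
    and on_arr_Id: "a \<in> Obj C \<Longrightarrow> on_arr F (Id C a) = Id D (on_obj F a)"
    and on_arr_Comp: "\<lbrakk>f \<in> Arr C; g \<in> Arr C; Cod C f = Dom C g\<rbrakk>
      \<Longrightarrow> on_arr F (Comp C f g) = Comp D (on_arr F f) (on_arr F g)"

definition pullback ::
  "('o1, 'm1) cat \<Rightarrow> ('o2, 'm2) cat \<Rightarrow> ('o1, 'm1, 'o, 'm) fctr \<Rightarrow> ('o2, 'm2, 'o, 'm) fctr
    \<Rightarrow> ('o1 \<times> 'o2, 'm1 \<times> 'm2) cat" where
  "pullback C D F G =
    \<lparr>Obj = {(a, b). a \<in> Obj C \<and> b \<in> Obj D \<and> on_obj F a = on_obj G b},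
     Arr = {(f, g). f \<in> Arr C \<and> g \<in> Arr D \<and> on_arr F f = on_arr G g},
     Dom = (\<lambda>(f, g). (Dom C f, Dom D g)),
     Cod = (\<lambda>(f, g). (Cod C f, Cod D g)),
     Id = (\<lambda>(a, b). (Id C a, Id D b)),
     Comp = (\<lambda>(f, g) (f', g'). (Comp C f f', Comp D g g'))\<rparr>"

text \<open>
  A (strict) double category, i.e. a category internal to Cat, with source \<open>S\<close>, target \<open>T\<close>,
  identities \<open>I\<close> and composition \<open>H\<close>. Each axiom is an equation of functors, stated on objects
  and on morphisms; \<open>H\<close> takes a pair \<open>(x, y)\<close> with \<open>T x = S y\<close>, again in diagrammatic order.
\<close>

locale double_category =
  D0: category D0 + D1: category D1 + S: cat_functor D1 D0 S + T: cat_functor D1 D0 T +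
  I: cat_functor D0 D1 I + H: cat_functor "pullback D1 D1 T S" D1 H
  for D0 :: "('o, 'v) cat" and D1 :: "('h, 's) cat"
    and S :: "('h, 's, 'o, 'v) fctr" and T :: "('h, 's, 'o, 'v) fctr"
    and I :: "('o, 'v, 'h, 's) fctr" and H :: "('h \<times> 'h, 's \<times> 's, 'h, 's) fctr" +
  assumes S_I_obj: "a \<in> Obj D0 \<Longrightarrow> on_obj S (on_obj I a) = a"
    and S_I_arr: "l \<in> Arr D0 \<Longrightarrow> on_arr S (on_arr I l) = l"
    and T_I_obj: "a \<in> Obj D0 \<Longrightarrow> on_obj T (on_obj I a) = a"
    and T_I_arr: "l \<in> Arr D0 \<Longrightarrow> on_arr T (on_arr I l) = l"
    and S_H_obj: "\<lbrakk>f \<in> Obj D1; g \<in> Obj D1; on_obj T f = on_obj S g\<rbrakk>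
      \<Longrightarrow> on_obj S (on_obj H (f, g)) = on_obj S f"
    and S_H_arr: "\<lbrakk>x \<in> Arr D1; y \<in> Arr D1; on_arr T x = on_arr S y\<rbrakk>
      \<Longrightarrow> on_arr S (on_arr H (x, y)) = on_arr S x"
    and T_H_obj: "\<lbrakk>f \<in> Obj D1; g \<in> Obj D1; on_obj T f = on_obj S g\<rbrakk>
      \<Longrightarrow> on_obj T (on_obj H (f, g)) = on_obj T g"
    and T_H_arr: "\<lbrakk>x \<in> Arr D1; y \<in> Arr D1; on_arr T x = on_arr S y\<rbrakk>
      \<Longrightarrow> on_arr T (on_arr H (x, y)) = on_arr T y"
    and H_I_left_obj: "f \<in> Obj D1 \<Longrightarrow> on_obj H (on_obj I (on_obj S f), f) = f"
    and H_I_left_arr: "x \<in> Arr D1 \<Longrightarrow> on_arr H (on_arr I (on_arr S x), x) = x"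
    and H_I_right_obj: "f \<in> Obj D1 \<Longrightarrow> on_obj H (f, on_obj I (on_obj T f)) = f"
    and H_I_right_arr: "x \<in> Arr D1 \<Longrightarrow> on_arr H (x, on_arr I (on_arr T x)) = x"
    and H_assoc_obj: "\<lbrakk>f \<in> Obj D1; g \<in> Obj D1; h \<in> Obj D1;
        on_obj T f = on_obj S g; on_obj T g = on_obj S h\<rbrakk>
      \<Longrightarrow> on_obj H (on_obj H (f, g), h) = on_obj H (f, on_obj H (g, h))"
    and H_assoc_arr: "\<lbrakk>x \<in> Arr D1; y \<in> Arr D1; z \<in> Arr D1;
        on_arr T x = on_arr S y; on_arr T y = on_arr S z\<rbrakk>
      \<Longrightarrow> on_arr H (on_arr H (x, y), z) = on_arr H (x, on_arr H (y, z))"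


section \<open>Multiway rewriting systems with homotopy rules\<close>

definition rewrite :: "('c list \<times> 'c list) set \<Rightarrow> ('c list \<times> 'c list) set" where
  "rewrite R = {(x @ u @ y, x @ v @ y) |x u v y. (u, v) \<in> R}"

record 'c system =
  states :: "'c list set"
  vrules :: "('c list \<times> 'c list) set"
  hrules :: "('c list \<times> 'c list) set"

definition vedges :: "'c system \<Rightarrow> ('c list \<times> 'c list) set" where
  "vedges M = rewrite (vrules M) \<inter> states M \<times> states M"

definition hedges :: "'c system \<Rightarrow> ('c list \<times> 'c list) set" where
  "hedges M = rewrite (hrules M) \<inter> states M \<times> states M"

text \<open>
  There is at most one edge of each kind between two states, so a directed path is given by the
  nonempty list of states it visits; \<open>[s]\<close> is the empty path at \<open>s\<close>.
\<close>

definition paths :: "'s set \<Rightarrow> ('s \<times> 's) set \<Rightarrow> 's list set" where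
  "paths X E = {p. p \<noteq> [] \<and> set p \<subseteq> X \<and> successively (\<lambda>s t. (s, t) \<in> E) p}"

definition concat_path :: "'s list \<Rightarrow> 's list \<Rightarrow> 's list" where
  "concat_path p q = p @ tl q"

definition vmor :: "'c system \<Rightarrow> 'c list list set" where
  "vmor M = paths (states M) (vedges M)"

definition hmor :: "'c system \<Rightarrow> 'c list list set" where
  "hmor M = paths (states M) (hedges M)"

text \<open>As each frame bounds exactly one square, a square is identified with its frame.\<close>

datatype 's square =
  Square (sq_left: "'s list") (sq_right: "'s list") (sq_top: "'s list") (sq_bot: "'s list")

definition squares :: "'c system \<Rightarrow> 'c list square set" where
  "squares M = {Square l m f g |l m f g. l \<in> vmor M \<and> m \<in> vmor M \<and> f \<in> hmor M \<and> g \<in> hmor M \<and>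
     hd l = hd f \<and> last l = hd g \<and> hd m = last f \<and> last m = last g}"

definition vpaste :: "'s square \<Rightarrow> 's square \<Rightarrow> 's square" where
  "vpaste x y = Square (concat_path (sq_left x) (sq_left y)) (concat_path (sq_right x) (sq_right y))
     (sq_top x) (sq_bot y)"

definition hpaste :: "'s square \<Rightarrow> 's square \<Rightarrow> 's square" where
  "hpaste x y = Square (sq_left x) (sq_right y)
     (concat_path (sq_top x) (sq_top y)) (concat_path (sq_bot x) (sq_bot y))"

definition cat0 :: "'c system \<Rightarrow> ('c list, 'c list list) cat" where
  "cat0 M = \<lparr>Obj = states M, Arr = vmor M, Dom = hd, Cod = last,
     Id = (\<lambda>s. [s]), Comp = concat_path\<rparr>"

definition cat1 :: "'c system \<Rightarrow> ('c list list, 'c list square) cat" where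
  "cat1 M = \<lparr>Obj = hmor M, Arr = squares M, Dom = sq_top, Cod = sq_bot,
     Id = (\<lambda>f. Square [hd f] [last f] f f), Comp = vpaste\<rparr>"

definition src :: "('s list, 's square, 's, 's list) fctr" where
  "src = \<lparr>on_obj = hd, on_arr = sq_left\<rparr>"

definition trg :: "('s list, 's square, 's, 's list) fctr" where
  "trg = \<lparr>on_obj = last, on_arr = sq_right\<rparr>"

definition hid :: "('s, 's list, 's list, 's square) fctr" where
  "hid = \<lparr>on_obj = (\<lambda>s. [s]), on_arr = (\<lambda>l. Square l l [hd l] [last l])\<rparr>"

definition hcomp :: "('s list \<times> 's list, 's square \<times> 's square, 's list, 's square) fctr" where
  "hcomp = \<lparr>on_obj = (\<lambda>(f, g). concat_path f g), on_arr = (\<lambda>(x, y). hpaste x y)\<rparr>"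

text \<open>
  \<open>two_morphism M xs p q\<close>: the squares \<open>xs\<close>, listed from top to bottom, paste to a 2-morphism
  from \<open>p\<close> to \<open>q\<close>. Since the first and last squares are triangles, there are at least two squares;
  a single square with both horizontal sides identities, which exists for any two parallel paths,
  does not count.
\<close>

definition two_morphism ::
  "'c system \<Rightarrow> 'c list square list \<Rightarrow> 'c list list \<Rightarrow> 'c list list \<Rightarrow> bool" where
  "two_morphism M xs p q \<longleftrightarrow>
     p \<in> vmor M \<and> q \<in> vmor M \<and> hd p = hd q \<and> last p = last q \<and>
     2 \<le> length xs \<and> set xs \<subseteq> squares M \<and> successively (\<lambda>x y. sq_bot x = sq_top y) xs \<and>
     foldr vpaste (butlast xs) (last xs) = Square p q [hd p] [last p] \<and>
     (\<forall>x \<in> set (butlast xs). \<exists>s t. sq_bot x = [s, t] \<and> (s, t) \<in> hedges M)"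

definition multiway_system :: "'c system \<Rightarrow> bool" where
  "multiway_system M \<longleftrightarrow>
     (\<forall>s t. s \<in> states M \<and> (s, t) \<in> rewrite (vrules M) \<longrightarrow> t \<in> states M)"

text \<open>
  That the homotopy rules give 2-morphisms is read as: there are homotopy rules, they act on the
  states, and each of them is used by an intermediate horizontal side of some 2-morphism.
\<close>

definition order2_homotopy_system :: "'c system \<Rightarrow> bool" where
  "order2_homotopy_system M \<longleftrightarrow>
     multiway_system M \<and>
     (\<forall>s t. s \<in> states M \<and> (s, t) \<in> rewrite (hrules M) \<longrightarrow> t \<in> states M) \<and>
     hrules M \<noteq> {} \<and>
     (\<forall>r \<in> hrules M. \<exists>xs p q. two_morphism M xs p q \<and>
        (\<exists>x \<in> set (butlast xs). \<exists>s t. sq_bot x = [s, t] \<and> (s, t) \<in> rewrite {r}))"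


section \<open>The system on strings reachable from AA\<close>

datatype letter = A | B

definition V :: "letter list set" where
  "V = {s. ([A, A], s) \<in> (rewrite {([A], [A, B])})\<^sup>*}"

definition homotopy_pairs :: "(letter list \<times> letter list) set" where
  "homotopy_pairs =
     {([A, A, B], [A, B, A]),
      ([A, A, B, B], [A, B, B, A]),
      ([A, A, B, B, B], [A, B, B, B, A]),
      ([A, B, A, B, B, B], [A, B, B, B, A, B]),
      ([A, B, B, A, B, B, B], [A, B, B, B, A, B, B])}"

definition M :: "letter system" where
  "M = \<lparr>states = V, vrules = {([A], [A, B])}, hrules = homotopy_pairs \<union> homotopy_pairs\<inverse>\<rparr>"

end

theory Submission
  imports Defs
begin

text \<open>
  The statement has three parts of quite different nature.

  The double category owes nothing to the particular rules. For every system \<open>N\<close>, vertical and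
  horizontal morphisms are paths in two directed graphs on the same vertices, and both kinds compose
  by concatenation. A square is its frame, so pasting squares in either direction is concatenation
  of two opposite sides, and each axiom, the interchange law included, reduces to associativity and
  unit laws for concatenation, side by side (\<open>double_category_of_system\<close>).

  The 2-morphism between the two given paths is a ladder: the intermediate states of the two paths
  at equal height are exactly the two sides of the five homotopy pairs, so each rung is a rule
  applied in the empty context, and the ends of the ladder close up in triangles at \<open>AA\<close> and
  \<open>ABBBABBB\<close>.

  For the system being of order 2, the point is a description of the states. The rule \<open>A \<rightarrow> AB\<close>
  lengthens one of the two blocks of letters \<open>B\<close> in \<open>AA\<close>, so the states are the words
  \<open>A B\<^sup>m A B\<^sup>n\<close>, which are also the words that start with \<open>A\<close> and contain \<open>A\<close> exactly twice
  (\<open>in_V_iff_count\<close>). The second form shows that the homotopy rules preserve the states, as their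
  two sides both start with \<open>A\<close> and have equally many letters \<open>A\<close>. The first form shows that
  reachability is the product order on pairs \<open>(m, n)\<close>, which has a least element and upper
  bounds. Hence the two ends of any horizontal edge have a common ancestor and a common
  descendant, and the edge is the only rung of a ladder with two triangles
  (\<open>hedge_in_two_morphism\<close>); this applies to every homotopy rule, because its two sides are
  states themselves.
\<close>

section \<open>Paths and their concatenation\<close>

lemma singleton_path: "s \<in> X \<Longrightarrow> [s] \<in> paths X E"
  by (simp add: paths_def)

lemma path_ends:
  assumes "p \<in> paths X E"
  shows "hd p \<in> X" "last p \<in> X"
  using assms by (auto simp: paths_def)

lemma path_nonempty: "p \<in> paths X E \<Longrightarrow> p \<noteq> []"
  by (simp add: paths_def)

lemma concat_path_in_paths:
  assumes "p \<in> paths X E" "q \<in> paths X E" "last p = hd q"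
  shows "concat_path p q \<in> paths X E"
proof -
  obtain s q' where q: "q = s # q'"
    using path_nonempty[OF assms(2)] by (cases q) auto
  show ?thesis
    using assms unfolding q paths_def concat_path_def
    by (cases q') (auto simp: successively_append_iff)
qed

lemma hd_concat_path: "p \<noteq> [] \<Longrightarrow> hd (concat_path p q) = hd p"
  by (simp add: concat_path_def)

lemma last_concat_path: "q \<noteq> [] \<Longrightarrow> last p = hd q \<Longrightarrow> last (concat_path p q) = last q"
  by (cases q) (auto simp: concat_path_def)

lemma concat_path_singleton_left: "p \<noteq> [] \<Longrightarrow> s = hd p \<Longrightarrow> concat_path [s] p = p"
  by (simp add: concat_path_def)

lemma concat_path_singleton_right: "concat_path p [s] = p"
  by (simp add: concat_path_def)

lemma concat_path_assoc:
  "q \<noteq> [] \<Longrightarrow> concat_path (concat_path p q) r = concat_path p (concat_path q r)"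
  by (simp add: concat_path_def)

lemma path_of_rtrancl:
  assumes "(s, t) \<in> E\<^sup>*" "s \<in> X" "E `` X \<subseteq> X"
  obtains p where "p \<in> paths X (E \<inter> X \<times> X)" "hd p = s" "last p = t"
proof -
  have "\<exists>p \<in> paths X (E \<inter> X \<times> X). hd p = s \<and> last p = t"
    using assms(1)
  proof (induction rule: rtrancl_induct)
    case base
    show ?case using singleton_path[OF assms(2)] by force
  next
    case (step t u)
    then obtain p where p: "p \<in> paths X (E \<inter> X \<times> X)" "hd p = s" "last p = t" by blast
    have "t \<in> X" using path_ends(2)[OF p(1)] p(3) by simp
    moreover have "u \<in> X" using assms(3) step.hyps(2) \<open>t \<in> X\<close> by blast
    ultimately have "[t, u] \<in> paths X (E \<inter> X \<times> X)"
      using step.hyps(2) by (simp add: paths_def)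
    then have "concat_path p [t, u] \<in> paths X (E \<inter> X \<times> X)"
      using p by (intro concat_path_in_paths) auto
    then show ?case
      using p path_nonempty[OF p(1)]
      by (intro bexI[of _ "concat_path p [t, u]"]) (auto simp: hd_concat_path last_concat_path)
  qed
  then show thesis using that by blast
qed


section \<open>The double category of a rewriting system\<close>

text \<open>
  Operations act componentwise; compatible pairs are closed under them because \<open>F\<close> and \<open>G\<close>
  preserve domains, codomains, identities and composites.
\<close>

lemma category_pullback:
  assumes "cat_functor C K F" "cat_functor D K G"
  shows "category (pullback C D F G)"
proof -
  interpret F: cat_functor C K F by fact
  interpret G: cat_functor D K G by fact
  show ?thesis
  proof
    fix f assume "f \<in> Arr (pullback C D F G)"
    then show "Dom (pullback C D F G) f \<in> Obj (pullback C D F G)"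
      by (auto simp: pullback_def F.dom.Dom_in G.dom.Dom_in
          simp flip: F.Dom_on_arr G.Dom_on_arr)
  next
    fix f assume "f \<in> Arr (pullback C D F G)"
    then show "Cod (pullback C D F G) f \<in> Obj (pullback C D F G)"
      by (auto simp: pullback_def F.dom.Cod_in G.dom.Cod_in
          simp flip: F.Cod_on_arr G.Cod_on_arr)
  qed (auto simp: pullback_def
      F.dom.Id_in F.dom.Dom_Id F.dom.Cod_Id F.dom.Comp_in F.dom.Dom_Comp F.dom.Cod_Comp
      F.dom.Comp_Id_left F.dom.Comp_Id_right F.dom.Comp_assoc
      G.dom.Id_in G.dom.Dom_Id G.dom.Cod_Id G.dom.Comp_in G.dom.Dom_Comp G.dom.Cod_Comp
      G.dom.Comp_Id_left G.dom.Comp_Id_right G.dom.Comp_assoc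
      F.on_arr_Id G.on_arr_Id F.on_arr_Comp G.on_arr_Comp)
qed

lemma vmor_simps:
  assumes "p \<in> vmor N"
  shows "p \<noteq> []" "hd p \<in> states N" "last p \<in> states N"
  using assms path_ends path_nonempty unfolding vmor_def by blast+

lemma hmor_simps:
  assumes "f \<in> hmor N"
  shows "f \<noteq> []" "hd f \<in> states N" "last f \<in> states N"
  using assms path_ends path_nonempty unfolding hmor_def by blast+

lemma concat_in_vmor:
  "p \<in> vmor N \<Longrightarrow> q \<in> vmor N \<Longrightarrow> last p = hd q \<Longrightarrow> concat_path p q \<in> vmor N"
  by (simp add: vmor_def concat_path_in_paths)

lemma concat_in_hmor:
  "f \<in> hmor N \<Longrightarrow> g \<in> hmor N \<Longrightarrow> last f = hd g \<Longrightarrow> concat_path f g \<in> hmor N"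
  by (simp add: hmor_def concat_path_in_paths)

lemma singleton_in_vmor: "s \<in> states N \<Longrightarrow> [s] \<in> vmor N"
  by (simp add: vmor_def singleton_path)

lemma singleton_in_hmor: "s \<in> states N \<Longrightarrow> [s] \<in> hmor N"
  by (simp add: hmor_def singleton_path)

lemma Square_in_squares_iff:
  "Square l m f g \<in> squares N \<longleftrightarrow> l \<in> vmor N \<and> m \<in> vmor N \<and> f \<in> hmor N \<and> g \<in> hmor N \<and>
     hd l = hd f \<and> last l = hd g \<and> hd m = last f \<and> last m = last g"
  by (auto simp: squares_def)

lemma square_frame:
  assumes "x \<in> squares N"
  shows "sq_left x \<in> vmor N" "sq_right x \<in> vmor N" "sq_top x \<in> hmor N" "sq_bot x \<in> hmor N"
    "hd (sq_left x) = hd (sq_top x)" "last (sq_left x) = hd (sq_bot x)"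
    "hd (sq_right x) = last (sq_top x)" "last (sq_right x) = last (sq_bot x)"
  using assms by (auto simp: squares_def)

lemma vpaste_sides:
  "sq_left (vpaste x y) = concat_path (sq_left x) (sq_left y)"
  "sq_right (vpaste x y) = concat_path (sq_right x) (sq_right y)"
  "sq_top (vpaste x y) = sq_top x" "sq_bot (vpaste x y) = sq_bot y"
  by (simp_all add: vpaste_def)

lemma hpaste_sides:
  "sq_left (hpaste x y) = sq_left x" "sq_right (hpaste x y) = sq_right y"
  "sq_top (hpaste x y) = concat_path (sq_top x) (sq_top y)"
  "sq_bot (hpaste x y) = concat_path (sq_bot x) (sq_bot y)"
  by (simp_all add: hpaste_def)

lemmas path_calculus =
  concat_in_vmor concat_in_hmor singleton_in_vmor singleton_in_hmor vmor_simps hmor_simps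
  hd_concat_path last_concat_path concat_path_singleton_left concat_path_singleton_right
  concat_path_assoc Square_in_squares_iff

lemma vpaste_in_squares:
  "x \<in> squares N \<Longrightarrow> y \<in> squares N \<Longrightarrow> sq_bot x = sq_top y \<Longrightarrow> vpaste x y \<in> squares N"
  by (cases x; cases y) (auto simp: vpaste_def path_calculus)

lemma hpaste_in_squares:
  "x \<in> squares N \<Longrightarrow> y \<in> squares N \<Longrightarrow> sq_right x = sq_left y \<Longrightarrow> hpaste x y \<in> squares N"
  by (cases x; cases y) (auto simp: hpaste_def path_calculus)

lemma vpaste_assoc:
  assumes "y \<in> squares N"
  shows "vpaste (vpaste x y) z = vpaste x (vpaste y z)"
  using assms by (cases y) (auto simp: vpaste_def path_calculus)

lemma hpaste_assoc:
  assumes "y \<in> squares N"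
  shows "hpaste (hpaste x y) z = hpaste x (hpaste y z)"
  using assms by (cases y) (auto simp: hpaste_def path_calculus)

text \<open>
  Both sides have the same frame: the outer left and right sides are composed vertically, the outer
  top and bottom sides horizontally, and the inner sides disappear.
\<close>

lemma paste_interchange:
  "hpaste (vpaste x x') (vpaste y y') = vpaste (hpaste x y) (hpaste x' y')"
  by (simp add: hpaste_def vpaste_def)

lemma category_cat0: "category (cat0 N)"
  by unfold_locales (auto simp: cat0_def path_calculus)

lemma category_cat1: "category (cat1 N)"
proof
  fix x assume "x \<in> Arr (cat1 N)"
  then show "Comp (cat1 N) (Id (cat1 N) (Dom (cat1 N) x)) x = x"
    by (cases x) (auto simp: cat1_def vpaste_def path_calculus)
next
  fix x assume "x \<in> Arr (cat1 N)"
  then show "Comp (cat1 N) x (Id (cat1 N) (Cod (cat1 N) x)) = x"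
    by (cases x) (auto simp: cat1_def vpaste_def path_calculus)
qed (auto simp: cat1_def square_frame path_calculus vpaste_in_squares vpaste_sides vpaste_assoc)

lemma functor_src: "cat_functor (cat1 N) (cat0 N) src"
  using category_cat0[of N] category_cat1[of N]
  by (auto simp: cat_functor_def cat_functor_axioms_def cat0_def cat1_def src_def square_frame
      vpaste_sides path_calculus)

lemma functor_trg: "cat_functor (cat1 N) (cat0 N) trg"
  using category_cat0[of N] category_cat1[of N]
  by (auto simp: cat_functor_def cat_functor_axioms_def cat0_def cat1_def trg_def square_frame
      vpaste_sides path_calculus)

lemma functor_hid: "cat_functor (cat0 N) (cat1 N) hid"
  using category_cat0[of N] category_cat1[of N]
  by (auto simp: cat_functor_def cat_functor_axioms_def cat0_def cat1_def hid_def
      vpaste_def path_calculus)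

lemma functor_hcomp: "cat_functor (pullback (cat1 N) (cat1 N) trg src) (cat1 N) hcomp"
proof -
  have "category (pullback (cat1 N) (cat1 N) trg src)"
    using functor_trg functor_src by (rule category_pullback)
  then show ?thesis
    using category_cat1[of N]
    by (auto simp: cat_functor_def cat_functor_axioms_def pullback_def cat1_def hcomp_def trg_def
        src_def hpaste_in_squares concat_in_hmor paste_interchange hpaste_sides)
      (auto simp: hpaste_def path_calculus)
qed

lemma double_category_of_system: "double_category (cat0 N) (cat1 N) src trg hid hcomp"
proof -
  have unit: "hpaste (Square (sq_left x) (sq_left x) [hd (sq_left x)] [last (sq_left x)]) x = x"
    "hpaste x (Square (sq_right x) (sq_right x) [hd (sq_right x)] [last (sq_right x)]) = x"
    if "x \<in> squares N" for x
    using that by (auto simp: squares_def hpaste_def path_calculus)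
  show ?thesis
    using category_cat0[of N] category_cat1[of N] functor_src[of N] functor_trg[of N]
      functor_hid[of N] functor_hcomp[of N]
    by (auto simp: double_category_def double_category_axioms_def unit hpaste_assoc cat0_def
        cat1_def src_def trg_def hid_def hcomp_def hpaste_sides path_calculus)
qed


section \<open>The states\<close>

abbreviation grow :: "(letter list \<times> letter list) set" where
  "grow \<equiv> rewrite {([A], [A, B])}"

definition word :: "nat \<Rightarrow> nat \<Rightarrow> letter list" where
  "word m n = A # replicate m B @ A # replicate n B"

lemma grow_first: "(word m n, word (Suc m) n) \<in> grow"
  unfolding rewrite_def word_def
  by (intro CollectI exI[of _ "[]"] exI[of _ "[A]"] exI[of _ "[A, B]"]
      exI[of _ "replicate m B @ A # replicate n B"]) simp

lemma grow_second: "(word m n, word m (Suc n)) \<in> grow"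
  unfolding rewrite_def word_def
  by (intro CollectI exI[of _ "A # replicate m B"] exI[of _ "[A]"] exI[of _ "[A, B]"]
      exI[of _ "replicate n B"]) simp

lemma word_reaches:
  assumes "m \<le> m'" "n \<le> n'"
  shows "(word m n, word m' n') \<in> grow\<^sup>*"
proof -
  have "(word m n, word m' n) \<in> grow\<^sup>*"
    using assms(1) by (induction rule: dec_induct) (auto intro: grow_first rtrancl_into_rtrancl)
  also have "(word m' n, word m' n') \<in> grow\<^sup>*"
    using assms(2) by (induction rule: dec_induct) (auto intro: grow_second rtrancl_into_rtrancl)
  finally show ?thesis .
qed

lemma word_0_0: "word 0 0 = [A, A]"
  by (simp add: word_def)

lemma word_in_V: "word m n \<in> V"
  using word_reaches[of 0 m 0 n] by (simp add: V_def word_0_0)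

lemma all_B: "count_list w A = 0 \<Longrightarrow> w = replicate (length w) B"
proof (induction w)
  case (Cons c w)
  then show ?case by (cases c) auto
qed simp

lemma word_of_count:
  assumes "count_list s A = 2" "hd s = A"
  obtains m n where "s = word m n"
proof -
  obtain w where s: "s = A # w" and w: "count_list w A = 1"
    using assms by (cases s) auto
  then have "A \<in> set w" by (metis count_notin zero_neq_one)
  then obtain u v where uv: "w = u @ A # v" "A \<notin> set u" by (meson split_list_first)
  then have "u = replicate (length u) B" "v = replicate (length v) B"
    using w by (intro all_B; simp)+
  then have "s = word (length u) (length v)"
    using s uv(1) by (simp add: word_def)
  then show thesis by (rule that)
qed

text \<open>
  A rule whose sides both start with \<open>A\<close> keeps an initial \<open>A\<close>, whether it acts at the front of the
  word or further to the right. This covers the vertical rule and all homotopy rules.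
\<close>

lemma rewrite_preserves_count:
  assumes "(s, t) \<in> rewrite R" "count_list s A = 2" "hd s = A"
    and "\<And>u v. (u, v) \<in> R \<Longrightarrow>
      u \<noteq> [] \<and> v \<noteq> [] \<and> hd v = A \<and> count_list u A = count_list v A"
  shows "count_list t A = 2 \<and> hd t = A"
proof -
  obtain x u v y where "s = x @ u @ y" "t = x @ v @ y" and uv: "(u, v) \<in> R"
    using assms(1) by (auto simp: rewrite_def)
  then show ?thesis using assms(2,3) assms(4)[OF uv] by (auto simp: hd_append)
qed

lemma in_V_iff_count: "s \<in> V \<longleftrightarrow> count_list s A = 2 \<and> hd s = A"
proof
  assume "s \<in> V"
  then have "([A, A], s) \<in> grow\<^sup>*" by (simp add: V_def)
  then show "count_list s A = 2 \<and> hd s = A"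
  proof (induction rule: rtrancl_induct)
    case (step s t)
    then show ?case using rewrite_preserves_count[OF step.hyps(2)] by auto
  qed simp
next
  assume "count_list s A = 2 \<and> hd s = A"
  then obtain m n where "s = word m n" using word_of_count by blast
  then show "s \<in> V" by (simp add: word_in_V)
qed

lemma V_word:
  assumes "s \<in> V"
  obtains m n where "s = word m n"
  using assms word_of_count by (auto simp: in_V_iff_count)

lemma V_closed_grow: "s \<in> V \<Longrightarrow> (s, t) \<in> grow \<Longrightarrow> t \<in> V"
  unfolding V_def by (auto intro: rtrancl_into_rtrancl)

lemma homotopy_rule_counts:
  assumes "(u, v) \<in> hrules M"
  shows "count_list u A = 2" "hd u = A" "u \<noteq> []" "count_list v A = 2" "hd v = A" "v \<noteq> []"
  using assms by (auto simp: M_def homotopy_pairs_def)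

lemma V_closed_homotopy:
  assumes "s \<in> V" "(s, t) \<in> rewrite (hrules M)"
  shows "t \<in> V"
  using rewrite_preserves_count[OF assms(2)] assms(1) homotopy_rule_counts
  by (auto simp: in_V_iff_count)

lemma rule_in_rewrite: "(u, v) \<in> R \<Longrightarrow> (u, v) \<in> rewrite R"
  unfolding rewrite_def
  by (intro CollectI exI[of _ "[]"] exI[of _ u] exI[of _ v]) simp

lemma rule_in_hedges: "(u, v) \<in> hrules M \<Longrightarrow> (u, v) \<in> hedges M"
  using homotopy_rule_counts[of u v] rule_in_rewrite[of u v]
  by (simp add: hedges_def in_V_iff_count) (simp add: M_def in_V_iff_count)

lemma states_M: "states M = V"
  by (simp add: M_def)

lemma vedges_M: "vedges M = grow \<inter> V \<times> V"
  by (simp add: vedges_def M_def)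


section \<open>The 2-morphisms\<close>

lemma hedge_in_hmor: "(s, t) \<in> hedges N \<Longrightarrow> [s, t] \<in> hmor N"
  by (auto simp: hmor_def paths_def hedges_def)

lemma two_morphism_of_triangles:
  assumes edge: "(s, t) \<in> hedges N"
    and p: "p \<in> vmor N" "hd p = a" "last p = s" "p' \<in> vmor N" "hd p' = s" "last p' = b"
    and q: "q \<in> vmor N" "hd q = a" "last q = t" "q' \<in> vmor N" "hd q' = t" "last q' = b"
  shows "two_morphism N [Square p q [a] [s, t], Square p' q' [s, t] [b]]
    (concat_path p p') (concat_path q q')"
proof -
  have "a \<in> states N" "b \<in> states N" using p vmor_simps by blast+
  then show ?thesis
    using assms hedge_in_hmor[OF edge]
    by (auto simp: two_morphism_def vpaste_def path_calculus)
qed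

lemma vmor_between_words:
  assumes "m \<le> m'" "n \<le> n'"
  obtains p where "p \<in> vmor M" "hd p = word m n" "last p = word m' n'"
proof -
  have "grow `` V \<subseteq> V" using V_closed_grow by blast
  then obtain p where "p \<in> paths V (grow \<inter> V \<times> V)" "hd p = word m n" "last p = word m' n'"
    using path_of_rtrancl[OF word_reaches[OF assms] word_in_V] by blast
  then show thesis using that by (simp add: vmor_def states_M vedges_M)
qed

text \<open>
  The common ancestor of the two ends is \<open>AA\<close>; a common descendant comes from the larger of the two
  exponents in either block.
\<close>

lemma hedge_in_two_morphism:
  assumes "(s, t) \<in> hedges M"
  obtains x y p q where "two_morphism M [x, y] p q" "sq_bot x = [s, t]"
proof -
  have "s \<in> V" "t \<in> V" using assms by (auto simp: hedges_def states_M)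
  then obtain i j k l where st: "s = word i j" "t = word k l" by (metis V_word)
  obtain p where p: "p \<in> vmor M" "hd p = word 0 0" "last p = s"
    using vmor_between_words[of 0 i 0 j] st by auto
  obtain q where q: "q \<in> vmor M" "hd q = word 0 0" "last q = t"
    using vmor_between_words[of 0 k 0 l] st by auto
  obtain p' where p': "p' \<in> vmor M" "hd p' = s" "last p' = word (max i k) (max j l)"
    using vmor_between_words[of i "max i k" j "max j l"] st by auto
  obtain q' where q': "q' \<in> vmor M" "hd q' = t" "last q' = word (max i k) (max j l)"
    using vmor_between_words[of k "max i k" l "max j l"] st by auto
  show thesis
    using that two_morphism_of_triangles[OF assms p p' q q'] by simp
qed

lemma order2_M: "order2_homotopy_system M"
  unfolding order2_homotopy_system_def
proof (intro conjI ballI)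
  show "multiway_system M"
    unfolding multiway_system_def using V_closed_grow by (auto simp: M_def)
  show "\<forall>s t. s \<in> states M \<and> (s, t) \<in> rewrite (hrules M) \<longrightarrow> t \<in> states M"
    using V_closed_homotopy by (auto simp: states_M)
  show "hrules M \<noteq> {}" by (simp add: M_def homotopy_pairs_def)
next
  fix r assume r: "r \<in> hrules M"
  obtain u v where uv: "r = (u, v)" by (cases r)
  obtain x y p q where "two_morphism M [x, y] p q" "sq_bot x = [u, v]"
    using hedge_in_two_morphism[OF rule_in_hedges] r uv by blast
  then show "\<exists>xs p q. two_morphism M xs p q \<and>
      (\<exists>x \<in> set (butlast xs). \<exists>s t. sq_bot x = [s, t] \<and> (s, t) \<in> rewrite {r})"
    using rule_in_rewrite[of u v "{r}"] uv
    by (intro exI[of _ "[x, y]"] exI[of _ p] exI[of _ q]) auto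
qed

lemma word_vedges:
  "(word m n, word (Suc m) n) \<in> vedges M" "(word m n, word m (Suc n)) \<in> vedges M"
  by (simp_all add: vedges_M word_in_V grow_first grow_second)

text \<open>
  The vertical edges of the two paths, read in the form \<open>A B\<^sup>m A B\<^sup>n\<close>: the left
  path takes \<open>n\<close> to 3 and then \<open>m\<close>, the right path takes \<open>m\<close> to 3 and then \<open>n\<close>.
\<close>

lemma vedges_left:
  "([A, A], [A, A, B]) \<in> vedges M"
  "([A, A, B], [A, A, B, B]) \<in> vedges M"
  "([A, A, B, B], [A, A, B, B, B]) \<in> vedges M"
  "([A, A, B, B, B], [A, B, A, B, B, B]) \<in> vedges M"
  "([A, B, A, B, B, B], [A, B, B, A, B, B, B]) \<in> vedges M"
  "([A, B, B, A, B, B, B], [A, B, B, B, A, B, B, B]) \<in> vedges M"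
  using word_vedges(2)[of 0 0] word_vedges(2)[of 0 1] word_vedges(2)[of 0 2]
    word_vedges(1)[of 0 3] word_vedges(1)[of 1 3] word_vedges(1)[of 2 3]
  by (simp_all add: word_def eval_nat_numeral)

lemma vedges_right:
  "([A, A], [A, B, A]) \<in> vedges M"
  "([A, B, A], [A, B, B, A]) \<in> vedges M"
  "([A, B, B, A], [A, B, B, B, A]) \<in> vedges M"
  "([A, B, B, B, A], [A, B, B, B, A, B]) \<in> vedges M"
  "([A, B, B, B, A, B], [A, B, B, B, A, B, B]) \<in> vedges M"
  "([A, B, B, B, A, B, B], [A, B, B, B, A, B, B, B]) \<in> vedges M"
  using word_vedges(1)[of 0 0] word_vedges(1)[of 1 0] word_vedges(1)[of 2 0]
    word_vedges(2)[of 3 0] word_vedges(2)[of 3 1] word_vedges(2)[of 3 2]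
  by (simp_all add: word_def eval_nat_numeral)

lemma rungs:
  assumes "(u, v) \<in> homotopy_pairs"
  shows "(u, v) \<in> hedges M"
  using assms by (intro rule_in_hedges) (simp add: M_def)

lemma ladder:
  "two_morphism M
     [Square [[A, A], [A, A, B]] [[A, A], [A, B, A]] [[A, A]] [[A, A, B], [A, B, A]],
      Square [[A, A, B], [A, A, B, B]] [[A, B, A], [A, B, B, A]]
        [[A, A, B], [A, B, A]] [[A, A, B, B], [A, B, B, A]],
      Square [[A, A, B, B], [A, A, B, B, B]] [[A, B, B, A], [A, B, B, B, A]]
        [[A, A, B, B], [A, B, B, A]] [[A, A, B, B, B], [A, B, B, B, A]],
      Square [[A, A, B, B, B], [A, B, A, B, B, B]] [[A, B, B, B, A], [A, B, B, B, A, B]]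
        [[A, A, B, B, B], [A, B, B, B, A]] [[A, B, A, B, B, B], [A, B, B, B, A, B]],
      Square [[A, B, A, B, B, B], [A, B, B, A, B, B, B]]
        [[A, B, B, B, A, B], [A, B, B, B, A, B, B]]
        [[A, B, A, B, B, B], [A, B, B, B, A, B]] [[A, B, B, A, B, B, B], [A, B, B, B, A, B, B]],
      Square [[A, B, B, A, B, B, B], [A, B, B, B, A, B, B, B]]
        [[A, B, B, B, A, B, B], [A, B, B, B, A, B, B, B]]
        [[A, B, B, A, B, B, B], [A, B, B, B, A, B, B]] [[A, B, B, B, A, B, B, B]]]
     [[A, A], [A, A, B], [A, A, B, B], [A, A, B, B, B], [A, B, A, B, B, B],
      [A, B, B, A, B, B, B], [A, B, B, B, A, B, B, B]]
     [[A, A], [A, B, A], [A, B, B, A], [A, B, B, B, A], [A, B, B, B, A, B],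
      [A, B, B, B, A, B, B], [A, B, B, B, A, B, B, B]]"
  by (simp add: two_morphism_def Square_in_squares_iff vmor_def hmor_def paths_def states_M
      in_V_iff_count vedges_left vedges_right rungs homotopy_pairs_def vpaste_def concat_path_def)

theorem proposition3p1:
  shows "order2_homotopy_system M
    \<and> (\<exists>xs. two_morphism M xs
         [[A, A], [A, A, B], [A, A, B, B], [A, A, B, B, B], [A, B, A, B, B, B],
          [A, B, B, A, B, B, B], [A, B, B, B, A, B, B, B]]
         [[A, A], [A, B, A], [A, B, B, A], [A, B, B, B, A], [A, B, B, B, A, B],
          [A, B, B, B, A, B, B], [A, B, B, B, A, B, B, B]])
    \<and> double_category (cat0 M) (cat1 M) src trg hid hcomp"
  using order2_M ladder double_category_of_system by blast

end
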